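(* Let $\Gamma=\Gamma(\tfrac18)=\bigl\{\sum_{i=0}^{N} a_i 8^i : N\ge0,\ a_i\in\{0,2\}\bigr\}$. Given any $t\in\mathbb{R}\setminus\Gamma$, there exists some $\gamma\in\Gamma$ such that $\langle e_t,e_\gamma\rangle\neq0$ in $L^2(\mu_{3/8})$.
   Context: Here $e_s(x)=e^{2\pi i s x}$. For $\lambda\in(0,1)$, the Bernoulli measure $\mu_\lambda$ is the Borel probability measure on $\mathbb{R}$ that is the distribution of the random variable $\sum_{k=1}^\infty \omega_k\lambda^k$, where the $\omega_k$ are independent and take the values $\pm1$ with probability $\tfrac12$ each. Equivalently, it is the unique Borel probability measure with compact support satisfying $\mu_\lambda=\tfrac12(\mu_\lambda\circ\tau_+^{-1}+\mu_\lambda\circ\tau_-^{-1})$, where $\tau_\pm(x)=\lambda(x\pm1)$. Its Fourier transform is $\widehat\mu_\lambda(t)=\int e^{2\pi i x t}\,d\mu_\lambda(x)=\prod_{k=1}^\infty\cos(2\pi\lambda^k t)$. *)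

theory Defs
  imports "HOL-Probability.Probability"
begin

definition fair_signs :: "(nat \<Rightarrow> real) measure" where
  "fair_signs = PiM UNIV (\<lambda>_. uniform_count_measure {-1, 1})"

text \<open>The distribution of \<open>\<Sum>k\<ge>1. \<omega>\<^sub>k lam\<^sup>k\<close> with independent fair signs, reindexed from 0: \<open>\<omega> k\<close> is the sign of \<open>lam ^ (k + 1)\<close>.
  The definition is only meaningful for \<open>0 < lam < 1\<close>, where the series always converges.\<close>

definition bernoulli_measure :: "real \<Rightarrow> real measure" where
  "bernoulli_measure lam = distr fair_signs borel (\<lambda>\<omega>. \<Sum>k. \<omega> k * lam ^ Suc k)"

definition e :: "real \<Rightarrow> real \<Rightarrow> complex" where
  "e s x = exp (2 * of_real pi * \<i> * of_real s * of_real x)"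

text \<open>The \<open>L\<^sup>2(M)\<close> inner product on representatives, linear in the first argument. It is
  meant for square-integrable functions.\<close>

definition L2_inner :: "'a measure \<Rightarrow> ('a \<Rightarrow> complex) \<Rightarrow> ('a \<Rightarrow> complex) \<Rightarrow> complex" where
  "L2_inner M f g = (LINT x|M. f x * cnj (g x))"

definition Gamma_eighth :: "real set" where
  "Gamma_eighth = {\<Sum>i=0..N. a i * 8 ^ i | (a :: nat \<Rightarrow> real) (N :: nat). \<forall>i\<le>N. a i \<in> {0, 2}}"

lemma prob_space_fair_signs: "prob_space fair_signs"
  unfolding fair_signs_def
  by (intro prob_space_PiM prob_space_uniform_count_measure) auto

lemma measurable_signed_series:
  "(\<lambda>\<omega>. \<Sum>k. \<omega> k * lam ^ Suc k) \<in> borel_measurable fair_signs"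
proof -
  have "(\<lambda>\<omega>. \<omega> k) \<in> borel_measurable fair_signs" for k
  proof (rule measurable_compose)
    show "(\<lambda>\<omega>. \<omega> k) \<in> measurable fair_signs (uniform_count_measure {-1, 1})"
      unfolding fair_signs_def by (rule measurable_component_singleton) simp
    show "(\<lambda>x. x) \<in> borel_measurable (uniform_count_measure {-1, 1 :: real})"
      by (auto simp: measurable_def space_uniform_count_measure sets_uniform_count_measure)
  qed
  then show ?thesis
    by (intro borel_measurable_suminf borel_measurable_times borel_measurable_const)
qed

lemma prob_space_bernoulli_measure: "prob_space (bernoulli_measure lam)"
  unfolding bernoulli_measure_def
  by (intro prob_space.prob_space_distr prob_space_fair_signs measurable_signed_series)

lemma summable_signed_series:
  assumes "\<omega> \<in> space fair_signs" "0 < lam" "lam < 1"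
  shows "summable (\<lambda>k. \<omega> k * lam ^ Suc k)"
proof (rule summable_comparison_test')
  show "summable (\<lambda>k. lam ^ Suc k)"
    using assms by (intro summable_Suc_iff[THEN iffD2] summable_geometric) simp
  fix k
  have "\<omega> k \<in> {-1, 1}"
    using assms(1) by (auto simp: fair_signs_def space_PiM PiE_iff space_uniform_count_measure)
  then show "norm (\<omega> k * lam ^ Suc k) \<le> lam ^ Suc k"
    using assms by auto
qed

lemma integrable_e:
  "integrable (bernoulli_measure lam) (\<lambda>x. e s x * cnj (e t x))"
proof -
  interpret prob_space "bernoulli_measure lam" by (rule prob_space_bernoulli_measure)
  show ?thesis
  proof (rule integrable_const_bound[where B = 1])
    show "(\<lambda>x. e s x * cnj (e t x)) \<in> borel_measurable (bernoulli_measure lam)"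
      unfolding bernoulli_measure_def e_def
      by (simp, intro borel_measurable_continuous_onI continuous_intros)
  qed (simp add: e_def norm_mult)
qed

end

theory Submission
  imports Defs
begin

text \<open>Conditioning on the first sign gives \<open>F u = cos (lam * u) * F (lam * u)\<close> for the
  characteristic function of \<open>\<mu>\<close>, so a zero of \<open>F\<close> is a zero of some cosine factor. Hence if
  \<open>e t\<close> were orthogonal to all \<open>e \<gamma>\<close>, then each \<open>q - 3 * g\<close> with \<open>q = 3 * t / 2\<close> and
  \<open>g = \<gamma> / 2\<close> would be of the form \<open>(8 / 3) ^ j * p\<close> with \<open>p\<close> odd. The choices \<open>g = 0\<close> and
  \<open>g = 1\<close> make \<open>q\<close> an integer, and \<open>q \<mapsto> (q - 3 * a) / 8\<close>, with \<open>a \<in> {0, 1}\<close> the parity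
  of \<open>q\<close>, preserves the property while decreasing \<open>\<bar>q\<bar>\<close>; but \<open>q = 0\<close> fails it at \<open>g = 0\<close>.\<close>

lemma char_bernoulli_measure:
  "char (bernoulli_measure lam) u = (LINT \<omega>|fair_signs. iexp (u * (\<Sum>k. \<omega> k * lam ^ Suc k)))"
  unfolding char_def bernoulli_measure_def
  by (intro integral_distr measurable_signed_series borel_measurable_continuous_onI continuous_intros)

lemma real_distribution_bernoulli_measure: "real_distribution (bernoulli_measure lam)"
  using prob_space_bernoulli_measure
  by (auto simp: real_distribution_def real_distribution_axioms_def bernoulli_measure_def)

lemma char_bernoulli_measure_scale:
  assumes "0 < lam" "lam < 1"
  shows "char (bernoulli_measure lam) u = of_real (cos (lam * u)) * char (bernoulli_measure lam) (lam * u)"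
proof -
  let ?M = "uniform_count_measure {-1, 1 :: real}"
  let ?X = "\<lambda>\<omega>. \<Sum>k. \<omega> k * lam ^ Suc k :: real"
  interpret M: prob_space ?M by (rule prob_space_uniform_count_measure) auto
  interpret sequence_space ?M
    by unfold_locales
  have S: "S = fair_signs" by (simp add: fair_signs_def)
  interpret F: prob_space fair_signs by (rule prob_space_fair_signs)
  interpret P: pair_prob_space ?M fair_signs ..
  have meas [measurable]: "(\<lambda>\<omega>. iexp (v * ?X \<omega>)) \<in> borel_measurable fair_signs" for v
    by (rule measurable_compose[OF measurable_signed_series])
      (intro borel_measurable_continuous_onI continuous_intros)
  have shift [measurable]: "(\<lambda>(s, \<omega>). case_nat s \<omega>) \<in> measurable (?M \<Otimes>\<^sub>M fair_signs) fair_signs"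
    unfolding fair_signs_def by measurable
  have comp: "(\<lambda>p. iexp (u * ?X (case p of (s, \<omega>) \<Rightarrow> case_nat s \<omega>))) \<in> borel_measurable (?M \<Otimes>\<^sub>M fair_signs)"
    by (rule measurable_compose[OF shift meas])
  have int: "integrable (?M \<Otimes>\<^sub>M fair_signs) (\<lambda>p. iexp (u * ?X (case p of (s, \<omega>) \<Rightarrow> case_nat s \<omega>)))"
    by (rule P.integrable_const_bound[where B = 1, OF _ comp]) simp
  \<comment> \<open>Membership in the space forces all entries to be signs, so both series converge
    and the head may be split off.\<close>
  have split_first: "?X (case_nat s \<omega>) = lam * s + lam * ?X \<omega>" if "s \<in> {-1, 1}" "\<omega> \<in> space fair_signs" for s \<omega>
  proof -
    have sm: "summable (\<lambda>k. \<omega> k * lam ^ Suc k)"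
      using summable_signed_series that assms by blast
    have "case_nat s \<omega> \<in> space fair_signs"
      using that by (auto simp: fair_signs_def space_PiM PiE_iff space_uniform_count_measure split: nat.split)
    then have "summable (\<lambda>k. case_nat s \<omega> k * lam ^ Suc k)"
      using summable_signed_series assms by blast
    from suminf_split_head[OF this]
    have "?X (case_nat s \<omega>) = lam * s + (\<Sum>k. lam * (\<omega> k * lam ^ Suc k))"
      by (simp add: ac_simps)
    then show ?thesis using suminf_mult[OF sm, of lam] by simp
  qed
  have inner: "(LINT \<omega>|fair_signs. iexp (u * ?X (case_nat s \<omega>)))
      = iexp (lam * u * s) * char (bernoulli_measure lam) (lam * u)" if "s \<in> {-1, 1}" for s
  proof -
    have "(LINT \<omega>|fair_signs. iexp (u * ?X (case_nat s \<omega>)))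
        = (LINT \<omega>|fair_signs. iexp (lam * u * s) * iexp (lam * u * ?X \<omega>))"
      by (intro Bochner_Integration.integral_cong refl, subst split_first[OF that])
        (simp_all add: exp_add[symmetric] algebra_simps)
    then show ?thesis by (simp add: char_bernoulli_measure)
  qed
  \<comment> \<open>Prepending an independent fair sign preserves the law \<open>fair_signs\<close>
    (\<open>PiM_iter\<close>); Fubini then isolates the average over that sign, which is the
    cosine.\<close>
  have "char (bernoulli_measure lam) u
      = (LINT \<omega>|(distr (?M \<Otimes>\<^sub>M fair_signs) fair_signs (\<lambda>(s, \<omega>). case_nat s \<omega>)). iexp (u * ?X \<omega>))"
    using PiM_iter unfolding S by (simp add: char_bernoulli_measure)
  also have "\<dots> = (LINT p|(?M \<Otimes>\<^sub>M fair_signs). iexp (u * ?X (case p of (s, \<omega>) \<Rightarrow> case_nat s \<omega>)))"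
    by (rule integral_distr[OF shift meas])
  also have "\<dots> = (LINT s|?M. LINT \<omega>|fair_signs. iexp (u * ?X (case_nat s \<omega>)))"
    using P.integral_fst'[OF int] by simp
  also have "\<dots> = (LINT s|?M. iexp (lam * u * s) * char (bernoulli_measure lam) (lam * u))"
    by (intro Bochner_Integration.integral_cong refl inner) (simp add: space_uniform_count_measure)
  also have "\<dots> = (iexp (lam * u) + iexp (- (lam * u))) / 2 * char (bernoulli_measure lam) (lam * u)"
    unfolding uniform_count_measure_def
    by (subst lebesgue_integral_point_measure_finite) (simp_all add: scaleR_conv_of_real field_simps)
  also have "(iexp (lam * u) + iexp (- (lam * u))) / 2 = of_real (cos (lam * u))"
    by (simp add: cos_exp_eq flip: cos_of_real)
  finally show ?thesis .
qed

text \<open>Only finitely many factors of the infinite product matter, since the characteristic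
  function is continuous and equals 1 at 0.\<close>

lemma char_bernoulli_measure_eq_0D:
  assumes "0 < lam" "lam < 1" "char (bernoulli_measure lam) u = 0"
  shows "\<exists>k. cos (lam ^ Suc k * u) = 0"
proof (rule ccontr)
  assume nz: "\<not> ?thesis"
  interpret real_distribution "bernoulli_measure lam"
    by (rule real_distribution_bernoulli_measure)
  let ?f = "char (bernoulli_measure lam)"
  \<comment> \<open>If no cosine factor vanishes, the scaling identity passes the zero from each
    point to \<open>lam\<close> times that point, and these points tend to 0.\<close>
  have vanish: "?f (lam ^ n * u) = 0" for n
  proof (induction n)
    case (Suc n)
    then show ?case
      using char_bernoulli_measure_scale[OF assms(1,2), of "lam ^ n * u"] nz
      by (auto simp: mult.assoc)
  qed (use assms(3) in simp)
  have "(\<lambda>n. lam ^ n * u) \<longlonglongrightarrow> 0"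
    using assms by (intro tendsto_mult_left_zero LIMSEQ_realpow_zero) auto
  then have "(\<lambda>n. ?f (lam ^ n * u)) \<longlonglongrightarrow> ?f 0"
    by (rule isCont_tendsto_compose[OF isCont_char])
  then show False
    unfolding vanish char_zero by (simp add: LIMSEQ_const_iff)
qed

lemma L2_inner_e_eq_char: "L2_inner M (e s) (e t) = char M (2 * pi * (s - t))"
  unfolding L2_inner_def char_def e_def
  by (intro Bochner_Integration.integral_cong refl)
    (simp add: exp_cnj algebra_simps flip: exp_add)

text \<open>The cosine vanishes exactly at odd multiples of \<open>pi / 2\<close>; clearing
  denominators leaves \<open>8 ^ Suc j / 4 = 2 * 8 ^ j\<close>.\<close>

lemma L2_inner_e_eq_0D:
  assumes "L2_inner (bernoulli_measure (3/8)) (e s) (e t) = 0"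
  shows "\<exists>j p. odd p \<and> 3 ^ Suc j * (s - t) = 2 * 8 ^ j * of_int p"
proof -
  have "char (bernoulli_measure (3/8)) (2 * pi * (s - t)) = 0"
    using assms unfolding L2_inner_e_eq_char .
  from char_bernoulli_measure_eq_0D[OF _ _ this]
  obtain j where "cos ((3/8) ^ Suc j * (2 * pi * (s - t))) = 0"
    by auto
  then obtain p where p: "odd p" "(3/8) ^ Suc j * (2 * pi * (s - t)) = of_int p * (pi / 2)"
    unfolding cos_zero_iff_int by blast
  then have "pi * (3 ^ Suc j * (s - t)) = pi * (2 * 8 ^ j * of_int p)"
    by (simp add: power_divide field_simps)
  then show ?thesis using p(1) by (metis mult_cancel_left pi_neq_zero)
qed

lemma zero_in_Gamma_eighth: "0 \<in> Gamma_eighth"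
  unfolding Gamma_eighth_def by (auto intro!: exI[of _ "\<lambda>_. 0"] exI[of _ 0])

text \<open>Multiplication by 8 moves every base-8 digit up one place and frees place 0 for
  \<open>c\<close>.\<close>

lemma Gamma_eighth_shift:
  assumes "x \<in> Gamma_eighth" "c \<in> {0, 2}"
  shows "8 * x + c \<in> Gamma_eighth"
proof -
  from assms(1) obtain a N where x: "x = (\<Sum>i=0..N. a i * 8 ^ i)" and a: "\<forall>i\<le>N. a i \<in> {0, 2}"
    unfolding Gamma_eighth_def by blast
  have "8 * x + c = (\<Sum>i=0..Suc N. case_nat c a i * 8 ^ i)"
    unfolding x sum.atLeast0_atMost_Suc_shift sum_distrib_left by (simp add: ac_simps)
  moreover have "\<forall>i\<le>Suc N. case_nat c a i \<in> {0, 2}"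
    using a assms(2) by (auto split: nat.split)
  ultimately show ?thesis
    unfolding Gamma_eighth_def by blast
qed

text \<open>The descent rests on \<open>q - 3 * (8 * g + a) = 8 * (q' - 3 * g)\<close> for
  \<open>q = 8 * q' + 3 * a\<close>: the condition on \<open>q\<close> at \<open>8 * g + a\<close>
  becomes the one on \<open>q'\<close> at \<open>g\<close>.\<close>

lemma no_integer_orbit:
  fixes q :: int
  assumes "\<And>g::int. 2 * of_int g \<in> Gamma_eighth \<Longrightarrow> \<exists>j p. odd p \<and> 3 ^ j * (q - 3 * g) = 8 ^ j * p"
  shows False
  using assms
proof (induction "nat \<bar>q\<bar>" arbitrary: q rule: less_induct)
  case less
  have zero: "2 * of_int (0::int) \<in> Gamma_eighth"
    using zero_in_Gamma_eighth by simp
  obtain a where a: "a \<in> {0, 1}" and even_diff: "even (q - 3 * a)"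
    by (cases "even q") (auto intro: that[of 0] that[of 1])
  have shift: "2 * of_int (8 * g + a) \<in> Gamma_eighth" if "2 * of_int g \<in> Gamma_eighth" for g
    using Gamma_eighth_shift[OF that, of "2 * of_int a"] a by (auto simp: algebra_simps)
  \<comment> \<open>By the choice of \<open>a\<close> the left side is even while \<open>p\<close>
    is odd, so the exponent is positive and one factor 3 and one factor 8 split off.\<close>
  have step: "\<exists>j p. odd p \<and> 3 * 3 ^ j * (q - 3 * (8 * g + a)) = 8 * 8 ^ j * p"
    if g: "2 * of_int g \<in> Gamma_eighth" for g
  proof -
    obtain j p where jp: "odd p" "3 ^ j * (q - 3 * (8 * g + a)) = 8 ^ j * p"
      using less.prems[OF shift[OF g]] by blast
    have "q - 3 * (8 * g + a) = q - 3 * a - 24 * g" by simp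
    then have "even (q - 3 * (8 * g + a))" using even_diff by (metis dvd_diff even_mult_iff even_numeral)
    then have "even (8 ^ j * p)" using jp(2) by (metis even_mult_iff)
    then have "j \<noteq> 0" using jp(1) by (cases j) auto
    then obtain i where "j = Suc i" by (cases j) auto
    with jp show ?thesis by auto
  qed
  have "8 dvd q - 3 * a"
  proof -
    obtain j p where jp: "3 * 3 ^ j * (q - 3 * a) = 8 * 8 ^ j * p"
      using step[OF zero] by auto
    then have "8 dvd 3 ^ Suc j * (q - 3 * a)" by simp
    moreover have "coprime (8::int) (3 ^ Suc j)"
      using coprime_power_left_iff[of "2::int" 3 "3 ^ Suc j"] by simp
    ultimately show ?thesis by (simp add: coprime_dvd_mult_right_iff)
  qed
  then obtain q' where q': "q = 8 * q' + 3 * a" by (metis diff_eq_eq dvdE)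
  \<comment> \<open>Cancelling 8 leaves a surplus factor 3 on the left. It is coprime to
    \<open>8 ^ j\<close>, so it divides \<open>p\<close>, and the quotient is still odd.\<close>
  have "\<exists>j p. odd p \<and> 3 ^ j * (q' - 3 * g) = 8 ^ j * p"
    if g: "2 * of_int g \<in> Gamma_eighth" for g
  proof -
    obtain j p where p: "odd p" and eq: "3 * 3 ^ j * (q - 3 * (8 * g + a)) = 8 * 8 ^ j * p"
      using step[OF g] by blast
    from eq have eq': "3 * (3 ^ j * (q' - 3 * g)) = 8 ^ j * p"
      unfolding q' by (simp add: algebra_simps)
    then have "3 dvd 8 ^ j * p" by (metis dvd_triv_left)
    moreover have "coprime (3::int) (8 ^ j)"
      using coprime_power_right_iff[of "3::int" 2 "3 * j"] by (simp add: power_mult)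
    ultimately obtain r where r: "p = 3 * r" by (auto simp: coprime_dvd_mult_right_iff)
    have "odd r" "3 ^ j * (q' - 3 * g) = 8 ^ j * r" using p eq' r by auto
    then show ?thesis by blast
  qed
  moreover have "q \<noteq> 0"
    using less.prems[OF zero] by auto
  then have "nat \<bar>q'\<bar> < nat \<bar>q\<bar>" using q' a by auto
  ultimately show False using less.hyps by blast
qed

lemma no_spectral_real:
  fixes t :: real
  assumes "\<And>\<gamma>. \<gamma> \<in> Gamma_eighth \<Longrightarrow> \<exists>j p. odd p \<and> 3 ^ Suc j * (t - \<gamma>) = 2 * 8 ^ j * of_int p"
  shows False
proof -
  have two: "2 \<in> Gamma_eighth"
    using Gamma_eighth_shift[OF zero_in_Gamma_eighth, of 2] by simp
  obtain i p where ip: "odd p" "3 ^ Suc i * t = 2 * 8 ^ i * of_int p"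
    using assms[OF zero_in_Gamma_eighth] by auto
  obtain j r where jr: "odd r" "3 ^ Suc j * (t - 2) = 2 * 8 ^ j * of_int r"
    using assms[OF two] by auto
  \<comment> \<open>With both exponents positive, eliminating \<open>t\<close> from the two
    equations would make \<open>3 ^ Suc i * 3 ^ Suc j\<close> even.\<close>
  have "i = 0 \<or> j = 0"
  proof (rule ccontr)
    assume "\<not> ?thesis"
    then have ij: "even ((8::int) ^ i)" "even ((8::int) ^ j)" by auto
    have "3 ^ Suc j * (3 ^ Suc i * t) - 3 ^ Suc i * (3 ^ Suc j * (t - 2)) = 2 * 3 ^ Suc i * 3 ^ Suc j"
      by (simp add: algebra_simps)
    then have "3 ^ Suc j * (8 ^ i * of_int p) - 3 ^ Suc i * (8 ^ j * of_int r) = (3 ^ Suc i * 3 ^ Suc j :: real)"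
      unfolding ip(2) jr(2) by (simp add: algebra_simps)
    then have "of_int (3 ^ Suc j * (8 ^ i * p) - 3 ^ Suc i * (8 ^ j * r)) = (of_int (3 ^ Suc i * 3 ^ Suc j) :: real)"
      by simp
    then have "3 ^ Suc j * (8 ^ i * p) - 3 ^ Suc i * (8 ^ j * r) = 3 ^ Suc i * 3 ^ Suc j"
      unfolding of_int_eq_iff .
    moreover have "even (3 ^ Suc j * (8 ^ i * p) - 3 ^ Suc i * (8 ^ j * r))"
      using ij by simp
    ultimately show False by simp
  qed
  \<comment> \<open>A zero exponent gives \<open>3 * t = 2 * p\<close> or
    \<open>3 * (t - 2) = 2 * r\<close>; hence the witnesses \<open>p\<close> and
    \<open>r + 3\<close>.\<close>
  then obtain q :: int where q: "3 * t = 2 * of_int q"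
  proof
    assume "i = 0"
    then show ?thesis using ip that[of p] by simp
  next
    assume "j = 0"
    then show ?thesis using jr that[of "r + 3"] by simp
  qed
  show False
  proof (rule no_integer_orbit)
    fix g :: int
    assume "2 * of_int g \<in> Gamma_eighth"
    from assms[OF this] obtain j p where p: "odd p"
      and eq: "3 ^ Suc j * (t - 2 * of_int g) = 2 * 8 ^ j * of_int p" by blast
    have "3 ^ Suc j * (t - 2 * of_int g) = 3 ^ j * (3 * t - 6 * of_int g)" by (simp add: algebra_simps)
    then have "3 ^ j * (3 * t - 6 * of_int g) = 2 * 8 ^ j * of_int p"
      using eq by (simp add: algebra_simps)
    then have "2 * real_of_int (3 ^ j * (q - 3 * g)) = 2 * of_int (8 ^ j * p)"
      unfolding q by (simp add: algebra_simps)
    then have "real_of_int (3 ^ j * (q - 3 * g)) = of_int (8 ^ j * p)"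
      by (simp only: mult_cancel_left) simp
    then show "\<exists>j p. odd p \<and> 3 ^ j * (q - 3 * g) = 8 ^ j * p"
      using p unfolding of_int_eq_iff by blast
  qed
qed

theorem theorem4p1:
  fixes t :: real
  assumes "t \<in> UNIV - Gamma_eighth"
  shows "\<exists>\<gamma>\<in>Gamma_eighth. L2_inner (bernoulli_measure (3/8)) (e t) (e \<gamma>) \<noteq> 0"
  using no_spectral_real[of t] L2_inner_e_eq_0D[of t] by blast

end
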